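(* Let $I=\langle U^*,\preceq^*,v^*\rangle\in\mathcal J$ and let $G_I$ be the induced generation structure. Then for all $A\in\mathrm{Form}$ and $U\in U^*$: $U\Vdash_I A$ if and only if $W_U,U\Vvdash_{G_I}A$.
   Context: Formulas: $\mathrm{Var}$ is a countable set of variables; $\mathrm{Form}$ is generated from $\bot$ and $\mathrm{Var}$ by $\land,\lor,\to$; $\neg A$ abbreviates $A\to\bot$. An intuitionistic frame is a nonempty partially ordered set; all frames are rooted and tree-like (there is a least element, and for each element the set of elements below it is a finite chain). An intuitionistic model $\langle K,\le,v\rangle$ adds $v:\mathrm{Var}\to\mathcal P(K)$ with each $v(p)$ closed upwards; $\Vdash_I$ denotes the usual intuitionistic Kripke forcing relation of an intuitionistic model $I$. $\mathcal J$ is the class of the intuitionistic models satisfying the finite verification condition: for each node $k$, $\{p\in\mathrm{Var}: k\in v(p)\}$ is finite. Given $I=\langle U^*,\preceq^*,v^*\rangle\in\mathcal J$, for each $U\in U^*$ let $W_U=\langle K_U,\le_U,v_U\rangle$, where $K_U=\{U'\in U^*: U'\preceq^*U\}$, $\le_U$ is the restriction of $\preceq^*$ to $K_U$, and $v_U(p)=v^*(p)\cap K_U$. Let $\mathcal U=\{W_U: U\in U^*\}$, let $W_{U_1}\preceq W_{U_2}$ iff $U_1\preceq^*U_2$, and $G_I=\langle\mathcal U,\preceq\rangle$. Generation forcing for $G=G_I$, for $W\in\mathcal U$ with $W=\langle K_W,\le_W,v_W\rangle$ and $k\in K_W$: $W,k\Vvdash_G p$ iff $k\in v_W(p)$; $W,k\not\Vvdash_G\bot$;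 $W,k\Vvdash_G A\land B$ iff $W,k\Vvdash_G A$ and $W,k\Vvdash_G B$; $W,k\Vvdash_G A\lor B$ iff $W,k\Vvdash_G A$ or $W,k\Vvdash_G B$; $W,k\Vvdash_G A\to B$ iff for every $W'\succeq W$ and $k'\in K_{W'}$ with $k'\ge_{W'}k$, if $W',k'\Vvdash_G A$ then there is $k''\in K_{W'}$ with $k''\ge_{W'}k'$ and $W',k''\Vvdash_G B$. *)

theory Defs
  imports Main "HOL-Library.Countable"
begin

datatype 'v form =
    Bot
  | Var 'v
  | And "'v form" "'v form"
  | Or "'v form" "'v form"
  | Imp "'v form" "'v form"

abbreviation Neg :: "'v form \<Rightarrow> 'v form" where
  "Neg A \<equiv> Imp A Bot"

text \<open>Orders are sets of pairs, so that restricting a model to a set of nodes yields a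
  structure that is determined by its nodes, order and valuation on them.\<close>

record ('w, 'v) kmodel =
  nodes :: "'w set"
  kle :: "'w rel"
  val :: "'v \<Rightarrow> 'w set"

definition int_frame :: "'w set \<Rightarrow> 'w rel \<Rightarrow> bool" where
  "int_frame K le \<longleftrightarrow>
     K \<noteq> {} \<and> partial_order_on K le \<and>
     (\<exists>r\<in>K. \<forall>k\<in>K. (r, k) \<in> le) \<and>
     (\<forall>k\<in>K. finite {j\<in>K. (j, k) \<in> le} \<and> total_on {j\<in>K. (j, k) \<in> le} le)"

definition int_model :: "('w, 'v) kmodel \<Rightarrow> bool" where
  "int_model I \<longleftrightarrow>
     int_frame (nodes I) (kle I) \<and>
     (\<forall>p. val I p \<subseteq> nodes I \<and>
          (\<forall>k l. k \<in> val I p \<longrightarrow> (k, l) \<in> kle I \<longrightarrow> l \<in> val I p))"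

definition fin_ver_models :: "('w, 'v) kmodel set" where
  "fin_ver_models = {I. int_model I \<and> (\<forall>k\<in>nodes I. finite {p. k \<in> val I p})}"

primrec iforces :: "('w, 'v) kmodel \<Rightarrow> 'w \<Rightarrow> 'v form \<Rightarrow> bool" where
  "iforces I k Bot \<longleftrightarrow> False"
| "iforces I k (Var p) \<longleftrightarrow> k \<in> val I p"
| "iforces I k (And A B) \<longleftrightarrow> iforces I k A \<and> iforces I k B"
| "iforces I k (Or A B) \<longleftrightarrow> iforces I k A \<or> iforces I k B"
| "iforces I k (Imp A B) \<longleftrightarrow>
     (\<forall>k'\<in>nodes I. (k, k') \<in> kle I \<longrightarrow> iforces I k' A \<longrightarrow> iforces I k' B)"

record ('w, 'v) gen_struct =
  gmodels :: "('w, 'v) kmodel set"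
  gle :: "('w, 'v) kmodel rel"

primrec gforces ::
  "('w, 'v) gen_struct \<Rightarrow> ('w, 'v) kmodel \<Rightarrow> 'w \<Rightarrow> 'v form \<Rightarrow> bool" where
  "gforces G W k Bot \<longleftrightarrow> False"
| "gforces G W k (Var p) \<longleftrightarrow> k \<in> val W p"
| "gforces G W k (And A B) \<longleftrightarrow> gforces G W k A \<and> gforces G W k B"
| "gforces G W k (Or A B) \<longleftrightarrow> gforces G W k A \<or> gforces G W k B"
| "gforces G W k (Imp A B) \<longleftrightarrow>
     (\<forall>W'\<in>gmodels G. (W, W') \<in> gle G \<longrightarrow>
        (\<forall>k'\<in>nodes W'. (k, k') \<in> kle W' \<longrightarrow> gforces G W' k' A \<longrightarrow>
           (\<exists>k''\<in>nodes W'. (k', k'') \<in> kle W' \<and> gforces G W' k'' B)))"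

definition below :: "('w, 'v) kmodel \<Rightarrow> 'w \<Rightarrow> 'w set" where
  "below I U = {U' \<in> nodes I. (U', U) \<in> kle I}"

definition induced_model :: "('w, 'v) kmodel \<Rightarrow> 'w \<Rightarrow> ('w, 'v) kmodel" where
  "induced_model I U =
     \<lparr>nodes = below I U,
      kle = Restr (kle I) (below I U),
      val = (\<lambda>p. val I p \<inter> below I U)\<rparr>"

definition induced_gen :: "('w, 'v) kmodel \<Rightarrow> ('w, 'v) gen_struct" where
  "induced_gen I =
     \<lparr>gmodels = induced_model I ` nodes I,
      gle = {(induced_model I U1, induced_model I U2) | U1 U2.
               U1 \<in> nodes I \<and> U2 \<in> nodes I \<and> (U1, U2) \<in> kle I}\<rparr>"

end

theory Submission
  imports Defs
begin

text \<open>Generation forcing is monotone in the node, and \<open>U\<close> is the greatest node of \<open>W\<^sub>U\<close>.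
  Hence in the clause for \<open>A \<rightarrow> B\<close> the weakened conclusion \<open>\<exists>k''\<ge>k'\<close> may be evaluated at the
  greatest node of \<open>W'\<close>, and by monotonicity the premise may be tested there too, so
  the clause reduces to the intuitionistic one.\<close>

lemma int_model_order:
  assumes "int_model I"
  shows "refl_on (nodes I) (kle I)" "trans (kle I)" "antisym (kle I)"
  using assms
  by (auto simp: int_model_def int_frame_def partial_order_on_def preorder_on_def)

text \<open>By reflexivity \<open>U\<close> lies in its own down-set \<open>below I U\<close>, so
  equal node sets put \<open>U\<close> and \<open>V\<close> below each other, and antisymmetry
  identifies them.\<close>

lemma induced_model_inject:
  assumes "int_model I" "U \<in> nodes I" "V \<in> nodes I" "induced_model I U = induced_model I V"
  shows "U = V"
proof -
  have "below I U = below I V"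
    using assms(4) by (simp add: induced_model_def)
  then have "(U, V) \<in> kle I" "(V, U) \<in> kle I"
    using assms(2,3) refl_onD[OF int_model_order(1)[OF assms(1)]]
    by (auto simp: below_def)
  then show ?thesis
    using int_model_order(3)[OF assms(1)] by (auto dest: antisymD)
qed

text \<open>\<open>gle\<close> relates models rather than their indices; as
  \<open>induced_model I\<close> is injective on nodes, quantifying over later models amounts to
  quantifying over nodes \<open>V\<close> above \<open>U\<close>. The guard
  \<open>k \<in> below I V\<close> stems from restricting the order to the nodes of the later
  model.\<close>

lemma gforces_induced_Imp_iff:
  assumes "int_model I" "U \<in> nodes I"
  shows "gforces (induced_gen I) (induced_model I U) k (Imp A B) \<longleftrightarrow>
    (\<forall>V\<in>nodes I. (U, V) \<in> kle I \<longrightarrow>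
       (\<forall>k'\<in>below I V. k \<in> below I V \<longrightarrow> (k, k') \<in> kle I \<longrightarrow>
          gforces (induced_gen I) (induced_model I V) k' A \<longrightarrow>
          (\<exists>k''\<in>below I V. (k', k'') \<in> kle I \<and>
             gforces (induced_gen I) (induced_model I V) k'' B)))"
proof -
  have gle_iff: "(induced_model I U, induced_model I V) \<in> gle (induced_gen I) \<longleftrightarrow> (U, V) \<in> kle I"
    if "V \<in> nodes I" for V
    using that assms(2) induced_model_inject[OF assms(1)]
    by (auto simp: induced_gen_def)
  have gmodels: "gmodels (induced_gen I) = induced_model I ` nodes I"
    by (simp add: induced_gen_def)
  have nodes: "nodes (induced_model I V) = below I V" for V
    by (simp add: induced_model_def)
  have kle: "(k, l) \<in> kle (induced_model I V) \<longleftrightarrow>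
      (k, l) \<in> kle I \<and> k \<in> below I V \<and> l \<in> below I V" for k l V
    by (auto simp: induced_model_def)
  show ?thesis
    unfolding gforces.simps gmodels ball_simps nodes kle
    using gle_iff by auto
qed

text \<open>For an implication, transitivity turns every pair \<open>V\<close>, \<open>k'\<close> to
  be tested at \<open>l\<close> into one to be tested at \<open>k\<close>, so no induction
  hypothesis enters; variables use that valuations are closed upwards.\<close>

lemma gforces_induced_mono:
  assumes I: "int_model I" and U: "U \<in> nodes I"
    and kl: "k \<in> below I U" "l \<in> below I U" "(k, l) \<in> kle I"
    and "gforces (induced_gen I) (induced_model I U) k A"
  shows "gforces (induced_gen I) (induced_model I U) l A"
  using assms(6)
proof (induction A)
  case (Var p)
  then show ?case
    using I kl by (auto simp: induced_model_def int_model_def)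
next
  case (Imp A B)
  show ?case
    unfolding gforces_induced_Imp_iff[OF I U]
  proof (intro ballI impI)
    fix V k'
    assume V: "V \<in> nodes I" "(U, V) \<in> kle I"
      and k': "k' \<in> below I V" "(l, k') \<in> kle I"
      and A: "gforces (induced_gen I) (induced_model I V) k' A"
    \<comment> \<open>The chains are \<open>k\<close> \<le> \<open>U\<close> \<le> \<open>V\<close>
      and \<open>k\<close> \<le> \<open>l\<close> \<le> \<open>k'\<close>; the first keeps
      \<open>k\<close> a node of the model at \<open>V\<close>.\<close>
    have "(k, V) \<in> kle I" "(k, k') \<in> kle I"
      using kl V k' int_model_order(2)[OF I] by (auto simp: below_def dest: transD)
    then have "k \<in> below I V"
      using kl by (simp add: below_def)
    then show "\<exists>k''\<in>below I V. (k', k'') \<in> kle I \<and>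
        gforces (induced_gen I) (induced_model I V) k'' B"
      using Imp.prems[unfolded gforces_induced_Imp_iff[OF I U]] V k' A \<open>(k, k') \<in> kle I\<close>
      by blast
  qed
qed auto

theorem proposition31:
  fixes I :: "('w, 'v::countable) kmodel"
    and A :: "'v form"
    and U :: 'w
  assumes "I \<in> fin_ver_models"
    and "U \<in> nodes I"
  shows "iforces I U A \<longleftrightarrow> gforces (induced_gen I) (induced_model I U) U A"
proof -
  have I: "int_model I"
    using assms(1) by (simp add: fin_ver_models_def)
  have top: "V \<in> below I V" "(V, V) \<in> kle I" if "V \<in> nodes I" for V
    using that refl_onD[OF int_model_order(1)[OF I]] by (auto simp: below_def)
  show ?thesis
    using assms(2)
  proof (induction A arbitrary: U)
    case (Var p)
    then show ?case
      using top by (simp add: induced_model_def)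
  next
    case (Imp A B)
    let ?g = "\<lambda>V. gforces (induced_gen I) (induced_model I V)"
    have to_top: "?g V V C" if "V \<in> nodes I" "k \<in> below I V" "?g V k C" for V k C
      using gforces_induced_mono[OF I that(1,2) _ _ that(3)] that top
      by (auto simp: below_def)
    have "?g U U (Imp A B) \<longleftrightarrow> (\<forall>V\<in>nodes I. (U, V) \<in> kle I \<longrightarrow> ?g V V A \<longrightarrow> ?g V V B)"
      (is "?L \<longleftrightarrow> ?R")
    proof
      assume ?L
      show ?R
      proof (intro ballI impI)
        fix V
        assume V: "V \<in> nodes I" "(U, V) \<in> kle I" and A: "?g V V A"
        have "U \<in> below I V"
          using V Imp.prems by (simp add: below_def)
        \<comment> \<open>The clause is instantiated with \<open>k' = V\<close>, the greatest node
          of the model at \<open>V\<close>.\<close>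
        then obtain k'' where "k'' \<in> below I V" "?g V k'' B"
          using \<open>?L\<close>[unfolded gforces_induced_Imp_iff[OF I Imp.prems]] V A top[OF V(1)]
          by blast
        then show "?g V V B"
          using to_top V(1) by blast
      qed
    next
      assume R: ?R
      show ?L
        unfolding gforces_induced_Imp_iff[OF I Imp.prems]
      proof (intro ballI impI)
        fix V k'
        assume V: "V \<in> nodes I" "(U, V) \<in> kle I" and k': "k' \<in> below I V" and A: "?g V k' A"
        have "?g V V B"
          using R V to_top[OF V(1) k' A] by blast
        \<comment> \<open>The witness is \<open>k'' = V\<close>, which lies above every
          \<open>k'\<close> in \<open>below I V\<close>.\<close>
        then show "\<exists>k''\<in>below I V. (k', k'') \<in> kle I \<and> ?g V k'' B"
          using top[OF V(1)] k' by (auto simp: below_def)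
      qed
    qed
    \<comment> \<open>Only forcing at pairs \<open>V\<close>, \<open>V\<close> remains, which the
      induction hypotheses, general in the node, cover.\<close>
    then show ?case
      using Imp.IH by simp
  qed auto
qed

end
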